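(* Consider a constant-product pool with pre-correction reserves $R_A,R_B>0$ and pre-correction price $Q_-:=R_B/R_A$, and suppose liquidity provider (LP) fees are paid out and not compounded into reserves, so that the invariant $K:=R_AR_B$ is unchanged by swaps. Let $\gamma>0$ be the log-fee, fix the external price $P>0$ and define $m:=P/Q_-$. 1. (Buy-side correction; $m>e^{\gamma}$.) If arbitrage trading pushes the pool price to the fee-adjusted boundary $Q'=Pe^{-\gamma}$, then the total (mark-to-market plus paid-out fee) value of the LP's pool position, measured at price $P$, jumps by the multiplicative factor $1+J^{-}(m;\gamma)$, where $$J^{-}(m;\gamma):=\frac{2e^{\gamma/2}\sqrt m-m-e^{\gamma}}{m+1}=-\frac{(\sqrt m-e^{\gamma/2})^2}{m+1}<0.$$ 2. (Sell-side correction; $m<e^{-\gamma}$.) If arbitrage trading pushes the pool price to the fee-adjusted boundary $Q'=Pe^{+\gamma}$, then the total (mark-to-market plus paid-out fee) value of the LP's pool position, measured at price $P$, jumps by the multiplicative factor $1+J^{+}(m;\gamma)$, where $$J^{+}(m;\gamma):=\frac{2e^{-\gamma/2}\sqrt m-m-e^{-\gamma}}{m+1}=-\frac{(\sqrt m-e^{-\gamma/2})^2}{m+1}<0.$$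
   Context: The pool price is ($B$-reserve)/($A$-reserve). The mark-to-market value of reserves $(x,y)$ of assets $(A,B)$ at external price $P$ is $Px+y$ (in units of $B$), so the pre-correction value is $PR_A+R_B$. The LP owns the whole pool. Fee rule: if a swap changes the $B$-reserve from $R_B$ to $R_B'$, then for a buy-side swap (traders buy $A$ from the pool, $R_B'>R_B$) the fee paid out to the LP is $(e^{\gamma}-1)(R_B'-R_B)$, and for a sell-side swap (traders sell $A$ to the pool, $R_B'<R_B$) the fee paid out to the LP is $(1-e^{-\gamma})(R_B-R_B')$, both in units of $B$. The post-correction value is the mark-to-market value of the new reserves at price $P$ plus the paid-out fee; "jumps by the multiplicative factor $1+J$" means post-correction value $=(1+J)\times$ pre-correction value. *)

theory Defs
  imports Complex_Main
begin

definition pool_price :: "real \<Rightarrow> real \<Rightarrow> real" where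
  "pool_price RA RB = RB / RA"

text \<open>Values and fees are in units of \<open>B\<close>; \<open>P\<close> is the external price of \<open>A\<close>.\<close>

definition mark_to_market :: "real \<Rightarrow> real \<Rightarrow> real \<Rightarrow> real" where
  "mark_to_market P x y = P * x + y"

text \<open>The fee paid out for a swap moving the \<open>B\<close>-reserve from \<open>RB\<close> to \<open>RB'\<close>. The side of the
  swap is read off the reserves: buy-side if \<open>RB' > RB\<close>, sell-side if \<open>RB' < RB\<close>; the second
  branch gives fee \<open>0\<close> if \<open>RB' = RB\<close>.\<close>

definition paid_out_fee :: "real \<Rightarrow> real \<Rightarrow> real \<Rightarrow> real" where
  "paid_out_fee \<gamma> RB RB' =
     (if RB' > RB then (exp \<gamma> - 1) * (RB' - RB) else (1 - exp (-\<gamma>)) * (RB - RB'))"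

text \<open>The LP owns the whole pool and fees are not added to the reserves.\<close>

definition pre_value :: "real \<Rightarrow> real \<Rightarrow> real \<Rightarrow> real" where
  "pre_value P RA RB = mark_to_market P RA RB"

definition post_value :: "real \<Rightarrow> real \<Rightarrow> real \<Rightarrow> real \<Rightarrow> real \<Rightarrow> real" where
  "post_value \<gamma> P RB RA' RB' = mark_to_market P RA' RB' + paid_out_fee \<gamma> RB RB'"

text \<open>A swap from reserves \<open>(RA, RB)\<close> to \<open>(RA', RB')\<close> that keeps the constant-product invariant and
  ends at pool price \<open>Q'\<close>.\<close>

definition pushes_price_to :: "real \<Rightarrow> real \<Rightarrow> real \<Rightarrow> real \<Rightarrow> real \<Rightarrow> bool" where
  "pushes_price_to Q' RA RB RA' RB' \<longleftrightarrow>
     RA' > 0 \<and> RB' > 0 \<and> RA' * RB' = RA * RB \<and> pool_price RA' RB' = Q'"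

lemma ex1_pushes_price_to:
  assumes "RA > 0" "RB > 0" "Q' > 0"
  shows "\<exists>!(RA', RB'). pushes_price_to Q' RA RB RA' RB'"
proof -
  define x where "x = sqrt (RA * RB / Q')"
  have x: "x > 0" "x\<^sup>2 = RA * RB / Q'"
    unfolding x_def using assms by simp_all
  have "x * (Q' * x) = Q' * x\<^sup>2" by (simp add: power2_eq_square)
  also have "\<dots> = RA * RB" unfolding x(2) using assms(3) by simp
  finally have ex: "case (x, Q' * x) of (RA', RB') \<Rightarrow> pushes_price_to Q' RA RB RA' RB'"
    using x(1) assms(3) by (simp add: pushes_price_to_def pool_price_def)
  have uniq: "(a, b) = (x, Q' * x)" if "pushes_price_to Q' RA RB a b" for a b
  proof -
    have a: "a > 0" "a * b = RA * RB" "b / a = Q'"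
      using that unfolding pushes_price_to_def pool_price_def by simp_all
    have b: "b = Q' * a" using a(1) unfolding a(3)[symmetric] by simp
    have "RA * RB = Q' * a\<^sup>2" unfolding a(2)[symmetric] b by (simp add: power2_eq_square)
    then have "a = x" unfolding x_def using a(1) assms(3) by simp
    then show ?thesis using b by simp
  qed
  show ?thesis
  proof (rule ex1I, rule ex)
    fix p assume "case p of (RA', RB') \<Rightarrow> pushes_price_to Q' RA RB RA' RB'"
    then show "p = (x, Q' * x)" using uniq[of "fst p" "snd p"] by (simp add: case_prod_beta)
  qed
qed

text \<open>The two jumps \<open>J\<^sup>-\<close> (buy-side) and \<open>J\<^sup>+\<close> (sell-side).\<close>

definition J_buy :: "real \<Rightarrow> real \<Rightarrow> real" where
  "J_buy m \<gamma> = (2 * exp (\<gamma> / 2) * sqrt m - m - exp \<gamma>) / (m + 1)"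

definition J_sell :: "real \<Rightarrow> real \<Rightarrow> real" where
  "J_sell m \<gamma> = (2 * exp (-\<gamma> / 2) * sqrt m - m - exp (-\<gamma>)) / (m + 1)"

end

theory Submission
  imports Defs
begin

text \<open>Both sides are one computation with a signed log-fee \<open>g\<close> (\<open>g = \<gamma>\<close> for buy-side, \<open>g = - \<gamma>\<close>
  for sell-side): the target price is \<open>P e\<^bsup>-g\<^esup>\<close>, the fee is \<open>(e\<^bsup>g\<^esup> - 1) (R\<^sub>B' - R\<^sub>B)\<close>, and
  \<open>J\<^sup>+(m; \<gamma>) = J\<^sup>-(m; -\<gamma>)\<close>. The price condition says \<open>P R\<^sub>A' = e\<^bsup>g\<^esup> R\<^sub>B'\<close>, so value plus fee
  collapses to \<open>2 e\<^bsup>g\<^esup> R\<^sub>B' - (e\<^bsup>g\<^esup> - 1) R\<^sub>B\<close>; the invariant gives \<open>R\<^sub>B' = R\<^sub>B e\<^bsup>-g/2\<^esup> \<surd>m\<close>.\<close>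

lemma exp_half_squared: "(exp (x / 2))\<^sup>2 = exp x" for x :: real
  by (simp add: exp_double[symmetric])

lemma J_sell_eq_J_buy: "J_sell m \<gamma> = J_buy m (- \<gamma>)"
  by (simp add: J_sell_def J_buy_def)

lemma J_buy_eq:
  assumes "m \<ge> 0"
  shows "J_buy m g = - ((sqrt m - exp (g / 2))\<^sup>2 / (m + 1))"
proof -
  have "2 * exp (g / 2) * sqrt m - m - exp g = - ((sqrt m - exp (g / 2))\<^sup>2)"
    using assms by (simp add: power2_diff exp_half_squared)
  then show ?thesis
    by (simp add: J_buy_def)
qed

text \<open>For \<open>m \<ge> 0\<close> the square in \<open>J_buy_eq\<close> vanishes only at
  \<open>m = exp g\<close>. Excluding just this point serves both sides:
  \<open>m > exp \<gamma>\<close> with \<open>g = \<gamma>\<close>, and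
  \<open>m < exp (-\<gamma>)\<close> with \<open>g = -\<gamma>\<close>.\<close>

lemma J_buy_neg:
  assumes "m \<ge> 0" and "m \<noteq> exp g"
  shows "J_buy m g < 0"
proof -
  have "sqrt m \<noteq> exp (g / 2)"
    using assms by (metis exp_half_squared real_sqrt_pow2)
  then show ?thesis
    using assms(1) by (simp add: J_buy_eq)
qed

lemma pushes_price_to_reserves:
  assumes "RA > 0" and "RB > 0" and "P > 0"
    and "pushes_price_to (P * exp (- g)) RA RB RA' RB'"
  shows "P * RA' = exp g * RB'"
    and "RB' = RB * (exp (- g / 2) * sqrt (P / pool_price RA RB))"
proof -
  have pos: "RA' > 0" "RB' > 0" and inv: "RA' * RB' = RA * RB"
    and price: "RB' / RA' = P * exp (- g)"
    using assms(4) by (simp_all add: pushes_price_to_def pool_price_def)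
  show RA_value: "P * RA' = exp g * RB'"
    using price pos by (simp add: exp_minus field_simps)
  let ?s = "exp (- g / 2) * sqrt (P / pool_price RA RB)"
  \<comment> \<open>Multiplying the invariant by the target price gives \<open>RB'\<^sup>2\<close>,
    so both candidates for the new reserve have the same square; nonnegativity then identifies
    them.\<close>
  have "(RB * ?s)\<^sup>2 = exp (- g) * P * (RA * RB)"
    unfolding power_mult_distrib exp_half_squared
    using assms(1-3) by (simp add: pool_price_def power2_eq_square)
  also have "\<dots> = exp (- g) * (P * RA') * RB'"
    by (simp add: inv[symmetric])
  also have "\<dots> = RB'\<^sup>2"
    by (simp add: RA_value exp_minus power2_eq_square)
  finally have "RB'\<^sup>2 = (RB * ?s)\<^sup>2"
    by simp
  moreover have "RB * ?s \<ge> 0"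
    using assms(1-3) by (simp add: pool_price_def)
  ultimately show "RB' = RB * ?s"
    using pos(2) by (simp add: power2_eq_iff_nonneg)
qed

text \<open>The fee appears in linear form instead of as \<open>paid_out_fee\<close>, so the
  identity holds for either sign of \<open>g\<close> without a case split on the direction of the
  swap.\<close>

lemma value_after_correction:
  assumes "RA > 0" and "RB > 0" and "P > 0"
    and "pushes_price_to (P * exp (- g)) RA RB RA' RB'"
  shows "mark_to_market P RA' RB' + (exp g - 1) * (RB' - RB) =
    (1 + J_buy (P / pool_price RA RB) g) * pre_value P RA RB"
proof -
  define m where "m = P / pool_price RA RB"
  have m: "m > 0" "P * RA = m * RB"
    using assms(1-3) by (simp_all add: m_def pool_price_def)
  have "exp g * RB' = RB * (exp g * exp (- g / 2)) * sqrt m"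
    using pushes_price_to_reserves(2)[OF assms] by (simp add: m_def)
  also have "exp g * exp (- g / 2) = exp (g / 2)"
    by (simp add: exp_add[symmetric])
  finally have "mark_to_market P RA' RB' + (exp g - 1) * (RB' - RB) =
      RB * (2 * exp (g / 2) * sqrt m - exp g + 1)"
    using pushes_price_to_reserves(1)[OF assms]
    by (simp add: mark_to_market_def algebra_simps)
  \<comment> \<open>The denominator of \<open>J_buy\<close> is the old value in units of
    \<open>RB\<close>, since \<open>P * RA = m * RB\<close>.\<close>
  also have "\<dots> = (1 + J_buy m g) * (RB * (m + 1))"
    using m(1) by (simp add: J_buy_def field_simps)
  also have "RB * (m + 1) = pre_value P RA RB"
    by (simp add: pre_value_def mark_to_market_def m(2) algebra_simps)
  finally show ?thesis
    by (simp add: m_def)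
qed

text \<open>This decides which branch of \<open>paid_out_fee\<close> applies:
  \<open>RB' / RB\<close> is the square root of \<open>m / exp g\<close>, so it exceeds 1 exactly
  when \<open>m\<close> exceeds \<open>exp g\<close>.\<close>

lemma less_reserve_after_correction_iff:
  assumes "RA > 0" and "RB > 0" and "P > 0"
    and "pushes_price_to (P * exp (- g)) RA RB RA' RB'"
  shows "RB < RB' \<longleftrightarrow> exp g < P / pool_price RA RB"
proof -
  define m where "m = P / pool_price RA RB"
  have "RB < RB' \<longleftrightarrow> 1 < exp (- g / 2) * sqrt m"
    using pushes_price_to_reserves(2)[OF assms] assms(2) by (simp add: m_def)
  also have "\<dots> \<longleftrightarrow> exp (g / 2) < sqrt m"
    by (simp add: exp_minus field_simps)
  also have "\<dots> \<longleftrightarrow> sqrt (exp g) < sqrt m"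
    by (simp add: real_sqrt_unique[OF exp_half_squared])
  finally show ?thesis
    by (simp add: m_def)
qed

theorem lemma4p4:
  fixes R_A R_B \<gamma> P Q m :: real
  assumes "R_A > 0" and "R_B > 0" and "\<gamma> > 0" and "P > 0"
    and "Q = pool_price R_A R_B" and "m = P / Q"
  shows
    "(m > exp \<gamma> \<longrightarrow>
        (\<forall>R_A' R_B'. pushes_price_to (P * exp (-\<gamma>)) R_A R_B R_A' R_B' \<longrightarrow>
           post_value \<gamma> P R_B R_A' R_B' = (1 + J_buy m \<gamma>) * pre_value P R_A R_B) \<and>
        J_buy m \<gamma> = - ((sqrt m - exp (\<gamma> / 2))\<^sup>2 / (m + 1)) \<and>
        J_buy m \<gamma> < 0) \<and>
     (m < exp (-\<gamma>) \<longrightarrow>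
        (\<forall>R_A' R_B'. pushes_price_to (P * exp \<gamma>) R_A R_B R_A' R_B' \<longrightarrow>
           post_value \<gamma> P R_B R_A' R_B' = (1 + J_sell m \<gamma>) * pre_value P R_A R_B) \<and>
        J_sell m \<gamma> = - ((sqrt m - exp (-\<gamma> / 2))\<^sup>2 / (m + 1)) \<and>
        J_sell m \<gamma> < 0)"
proof -
  have m: "m > 0"
    using assms by (simp add: pool_price_def)
  have m_eq: "m = P / pool_price R_A R_B"
    using assms(5,6) by simp
  have buy: "post_value \<gamma> P R_B R_A' R_B' = (1 + J_buy m \<gamma>) * pre_value P R_A R_B"
    if "m > exp \<gamma>" and push: "pushes_price_to (P * exp (- \<gamma>)) R_A R_B R_A' R_B'" for R_A' R_B'
    using that(1) less_reserve_after_correction_iff[OF assms(1,2,4) push]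
      value_after_correction[OF assms(1,2,4) push]
    by (simp add: post_value_def paid_out_fee_def m_eq)
  have sell: "post_value \<gamma> P R_B R_A' R_B' = (1 + J_sell m \<gamma>) * pre_value P R_A R_B"
    if "m < exp (- \<gamma>)" and "pushes_price_to (P * exp \<gamma>) R_A R_B R_A' R_B'" for R_A' R_B'
  proof -
    \<comment> \<open>The double negation exhibits the sell-side boundary as the signed target with
      \<open>g = -\<gamma>\<close>.\<close>
    have push: "pushes_price_to (P * exp (- (- \<gamma>))) R_A R_B R_A' R_B'"
      using that(2) by simp
    have "\<not> R_B < R_B'"
      using that(1) less_reserve_after_correction_iff[OF assms(1,2,4) push] by (simp add: m_eq)
    then have "paid_out_fee \<gamma> R_B R_B' = (exp (- \<gamma>) - 1) * (R_B' - R_B)"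
      by (simp add: paid_out_fee_def algebra_simps)
    then show ?thesis
      using value_after_correction[OF assms(1,2,4) push]
      by (simp add: post_value_def J_sell_eq_J_buy m_eq)
  qed
  show ?thesis
    using m buy sell J_buy_eq[of m \<gamma>] J_buy_eq[of m "- \<gamma>"] J_buy_neg[of m \<gamma>] J_buy_neg[of m "- \<gamma>"]
    by (simp add: J_sell_eq_J_buy)
qed

end
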